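(* Let $\le$ be a monomial order on $\mathbb{N}^m$. Let $X$ be a finite set and let $\mathcal{Z}=\{A_n \mid n\in\mathcal{D}\}$ be a symmetric association scheme on $X$ whose matrices are indexed by a set $\mathcal{D}\subset\mathbb{N}^m$ containing $e_1,\dots,e_m$. For $i=1,\dots,m$ define $\Gamma_i\subseteq X\times X$ by $(x,y)\in\Gamma_i \iff (A_{e_i})_{xy}=1$, and let $G=(X,\Gamma)$ with $\Gamma=\Gamma_1\sqcup\cdots\sqcup\Gamma_m$. The following are equivalent: (i) $G$ is $m$-distance-regular with respect to the partition $\{\Gamma_i\mid i=1,\dots,m\}$ of its edges and the monomial order $\le$; moreover $\mathcal{D}$ is the set of all $m$-distances in $G$ and, for every $\ell\in\mathcal{D}$, $A_\ell$ is the $\ell$-th $m$-distance matrix of $G$; (ii) $\mathcal{Z}$ is a symmetric $m$-variate $P$-polynomial association scheme on $\mathcal{D}$ with respect to $\le$.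
   Context: $e_i\in\mathbb{N}^m$ is the vector with $1$ in position $i$ and $0$ elsewhere, $o=(0,\dots,0)$. A monomial order on $\mathbb{N}^m$ (identified with monomials $\boldsymbol{x}^a=x_1^{a_1}\cdots x_m^{a_m}$) is a total order $\le$ such that $a\le b$ implies $a+c\le b+c$ for all $c\in\mathbb{N}^m$, and which is a well-ordering; $a<b$ means $a\le b$, $a\ne b$. A symmetric association scheme on a finite set $X$ is a set of $X\times X$ $(0,1)$-matrices containing the identity $I$, summing to the all-ones matrix $J$, each symmetric, and whose linear span is closed under multiplication: $A_aA_b=\sum_c p_{ab}^cA_c$ (the $p_{ab}^c$ are the intersection numbers). An $m$-variate polynomial $v(\boldsymbol{x})$ has multidegree $n$ (w.r.t. $\le$) if $v=\sum_{a\le n} f_a\boldsymbol{x}^a$ with $f_n\neq0$. A commutative association scheme $\mathcal{Z}=\{A_n\mid n\in\mathcal{D}\}$ with $e_1,\dots,e_m\in\mathcal{D}\subset\mathbb{N}^m$ is $m$-variate $P$-polynomial on $\mathcal{D}$ with respect to $\le$ if: (1) whenever $n\in\mathcal{D}$ and $0\le n_i'\le n_i$ for all $i$, then $n'\in\mathcal{D}$; (2) for every $n\in\mathcal{D}$, $A_n=v_n(A_{e_1},\dots,A_{e_m})$ for an $m$-variate polynomial $v_n$ of multidegree $n$ all of whose monomials $\boldsymbol{x}^a$ satisfy $a\in\mathcal{D}$; (3) for each $i$ and each $a\in\mathcal{D}$, the product $A_{e_i}A_{e_1}^{a_1}\cdots A_{e_m}^{a_m}$ is a linear combination of $\{A_{e_1}^{b_1}\cdots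 A_{e_m}^{b_m}\mid b\in\mathcal{D},\ b\le a+e_i\}$. Graph notions: for a finite connected undirected graph $G=(X,\Gamma)$ with a partition $\Gamma=\Gamma_1\sqcup\cdots\sqcup\Gamma_m$ of its edges into nonempty classes, a walk is a finite sequence of edges $(\gamma_1,\dots,\gamma_L)$ with $\gamma_j=(y_j,y_{j+1})$ joining $y_1$ and $y_{L+1}$ (the empty walk joins any vertex to itself). Its $m$-length $\ell_m(\xi)\in\mathbb{N}^m$ has $i$-th coordinate the number of $j$ with $\gamma_j\in\Gamma_i$. The $m$-distance $d_m(x,y)$ is the $\le$-minimum of $\ell_m(\xi)$ over all walks $\xi$ between $x$ and $y$. The set of $m$-distances is $\{d_m(x,y)\mid x,y\in X\}$, and for an $m$-distance $\ell$ the $\ell$-th $m$-distance matrix $A_\ell$ is the $X\times X$ matrix with $(A_\ell)_{xy}=1$ if $d_m(x,y)=\ell$ and $0$ otherwise. $G$ is $m$-distance-regular with respect to the partition and $\le$ if $e_1,\dots,e_m$ are $m$-distances in $G$ and, for all $m$-distances $a,b,c$, the number of vertices $z$ with $d_m(x,z)=a$ and $d_m(z,y)=b$ is the same for all pairs $x,y$ with $d_m(x,y)=c$. *)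

theory Defs
  imports "HOL-Analysis.Analysis" "HOL-Library.Poly_Mapping"
begin

text \<open>
  Coordinates are indexed by a finite linearly ordered type \<open>'m\<close>, so that \<open>m = CARD('m)\<close> is an
  arbitrary positive number, \<open>\<nat>\<^sup>m\<close> is \<open>nat ^ 'm\<close>, the vector \<open>e\<^sub>i\<close> is \<open>axis i 1\<close>, and \<open>o\<close> is \<open>0\<close>.
  A monomial order is an explicit relation \<open>le\<close>; it is unrelated to the componentwise
  order \<open>\<le>\<close> of the type \<open>nat ^ 'm\<close>.  The finite set \<open>X\<close> is a finite type \<open>'x\<close>, and
  \<open>X \<times> X\<close> matrices are of type \<open>real ^ 'x ^ 'x\<close>.
\<close>

definition monomial_order :: "(nat ^ 'm \<Rightarrow> nat ^ 'm \<Rightarrow> bool) \<Rightarrow> bool" where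
  "monomial_order le \<longleftrightarrow>
     well_order_on UNIV {(a, b). le a b} \<and>
     (\<forall>a b c. le a b \<longrightarrow> le (a + c) (b + c))"


subsection \<open>Association schemes\<close>

text \<open>
  As usual the relations of a scheme are nonempty, i.e. its matrices are nonzero.  Since the
  indexed family sums to the all-ones matrix, the indexing is then automatically injective.
\<close>

definition association_scheme :: "'i set \<Rightarrow> ('i \<Rightarrow> real ^ 'x ^ 'x) \<Rightarrow> bool" where
  "association_scheme D A \<longleftrightarrow>
     finite D \<and>
     (\<forall>n\<in>D. A n \<noteq> 0 \<and> (\<forall>x y. A n $ x $ y \<in> {0, 1})) \<and>
     mat 1 \<in> A ` D \<and>
     (\<Sum>n\<in>D. A n) = (\<chi> x y. 1) \<and>
     (\<forall>n\<in>D. transpose (A n) \<in> A ` D) \<and>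
     (\<forall>M\<in>span (A ` D). \<forall>N\<in>span (A ` D). M ** N \<in> span (A ` D))"

definition commutative_association_scheme :: "'i set \<Rightarrow> ('i \<Rightarrow> real ^ 'x ^ 'x) \<Rightarrow> bool" where
  "commutative_association_scheme D A \<longleftrightarrow>
     association_scheme D A \<and> (\<forall>a\<in>D. \<forall>b\<in>D. A a ** A b = A b ** A a)"

definition symmetric_association_scheme :: "'i set \<Rightarrow> ('i \<Rightarrow> real ^ 'x ^ 'x) \<Rightarrow> bool" where
  "symmetric_association_scheme D A \<longleftrightarrow>
     association_scheme D A \<and> (\<forall>n\<in>D. transpose (A n) = A n)"


subsection \<open>Multivariate P-polynomial schemes\<close>

text \<open>
  The multiplication \<open>*\<close> and power \<open>^\<close> of type \<open>real ^ 'x ^ 'x\<close> are not those of matrices, hence the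
  use of iterated \<open>**\<close>.  The factors of \<open>mat_monomial B a\<close>, the product of all
  \<open>(B i)\<close> to the power \<open>a $ i\<close>, are taken in increasing order of \<open>i\<close>.
\<close>

definition mat_power :: "real ^ 'x ^ 'x \<Rightarrow> nat \<Rightarrow> real ^ 'x ^ 'x" where
  "mat_power M k = (((**) M) ^^ k) (mat 1)"

definition mat_monomial ::
    "('m \<Rightarrow> real ^ 'x ^ 'x) \<Rightarrow> nat ^ ('m::{finite,linorder}) \<Rightarrow> real ^ 'x ^ 'x" where
  "mat_monomial B a =
     foldr (\<lambda>i M. mat_power (B i) (a $ i) ** M) (sorted_list_of_set UNIV) (mat 1)"

text \<open>
  An \<open>m\<close>-variate polynomial is a finitely supported map from exponents to coefficients.
\<close>

type_synonym 'm mpolynomial = "nat ^ 'm \<Rightarrow>\<^sub>0 real"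

definition mpoly_eval ::
    "('m::{finite,linorder}) mpolynomial \<Rightarrow> ('m \<Rightarrow> real ^ 'x ^ 'x) \<Rightarrow> real ^ 'x ^ 'x" where
  "mpoly_eval v B = (\<Sum>a\<in>Poly_Mapping.keys v. Poly_Mapping.lookup v a *\<^sub>R mat_monomial B a)"

definition has_multidegree ::
    "(nat ^ 'm \<Rightarrow> nat ^ 'm \<Rightarrow> bool) \<Rightarrow> ('m::finite) mpolynomial \<Rightarrow> nat ^ 'm \<Rightarrow> bool" where
  "has_multidegree le v n \<longleftrightarrow>
     Poly_Mapping.lookup v n \<noteq> 0 \<and> (\<forall>a\<in>Poly_Mapping.keys v. le a n)"

definition P_polynomial_scheme ::
    "(nat ^ ('m::{finite,linorder}) \<Rightarrow> nat ^ ('m::{finite,linorder}) \<Rightarrow> bool) \<Rightarrow>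
     (nat ^ ('m::{finite,linorder})) set \<Rightarrow> (nat ^ ('m::{finite,linorder}) \<Rightarrow> real ^ 'x ^ 'x) \<Rightarrow> bool" where
  "P_polynomial_scheme le D A \<longleftrightarrow>
     commutative_association_scheme D A \<and>
     (\<forall>i. axis i 1 \<in> D) \<and>
     (\<forall>n\<in>D. \<forall>n'. (\<forall>i. n' $ i \<le> n $ i) \<longrightarrow> n' \<in> D) \<and>
     (\<forall>n\<in>D. \<exists>v. has_multidegree le v n \<and> Poly_Mapping.keys v \<subseteq> D \<and>
                A n = mpoly_eval v (\<lambda>i. A (axis i 1))) \<and>
     (\<forall>i. \<forall>a\<in>D. A (axis i 1) ** mat_monomial (\<lambda>j. A (axis j 1)) a
                  \<in> span {mat_monomial (\<lambda>j. A (axis j 1)) b | b. b \<in> D \<and> le b (a + axis i 1)})"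


subsection \<open>Graphs with partitioned edges\<close>

text \<open>
  A graph on \<open>'x\<close> with edges partitioned into classes indexed by \<open>'m\<close> is given by the family \<open>\<Gamma>\<close>
  of its classes; an undirected edge occurs in both orientations.
\<close>

definition graph_edges :: "('m \<Rightarrow> ('x \<times> 'x) set) \<Rightarrow> ('x \<times> 'x) set" where
  "graph_edges \<Gamma> = (\<Union>i. \<Gamma> i)"

fun walk :: "('x \<times> 'x) set \<Rightarrow> 'x \<Rightarrow> ('x \<times> 'x) list \<Rightarrow> 'x \<Rightarrow> bool" where
  "walk E x [] y \<longleftrightarrow> x = y"
| "walk E x ((u, v) # \<xi>) y \<longleftrightarrow> u = x \<and> (u, v) \<in> E \<and> walk E v \<xi> y"

definition connected_partitioned_graph :: "('m \<Rightarrow> ('x \<times> 'x) set) \<Rightarrow> bool" where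
  "connected_partitioned_graph \<Gamma> \<longleftrightarrow>
     (\<forall>i. \<Gamma> i \<noteq> {} \<and> sym (\<Gamma> i)) \<and> disjoint_family \<Gamma> \<and>
     (\<forall>x y. \<exists>\<xi>. walk (graph_edges \<Gamma>) x \<xi> y)"

definition m_length :: "('m::finite \<Rightarrow> ('x \<times> 'x) set) \<Rightarrow> ('x \<times> 'x) list \<Rightarrow> nat ^ 'm" where
  "m_length \<Gamma> \<xi> = (\<chi> i. length (filter (\<lambda>\<gamma>. \<gamma> \<in> \<Gamma> i) \<xi>))"

text \<open>\<open>ord.Least le\<close> is the minimum with respect to \<open>le\<close>.\<close>

definition m_distance ::
    "(nat ^ 'm \<Rightarrow> nat ^ 'm \<Rightarrow> bool) \<Rightarrow> ('m::finite \<Rightarrow> ('x \<times> 'x) set) \<Rightarrow> 'x \<Rightarrow> 'x \<Rightarrow> nat ^ 'm" where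
  "m_distance le \<Gamma> x y =
     ord.Least le (\<lambda>n. \<exists>\<xi>. walk (graph_edges \<Gamma>) x \<xi> y \<and> m_length \<Gamma> \<xi> = n)"

definition m_distances ::
    "(nat ^ 'm \<Rightarrow> nat ^ 'm \<Rightarrow> bool) \<Rightarrow> ('m::finite \<Rightarrow> ('x \<times> 'x) set) \<Rightarrow> (nat ^ 'm) set" where
  "m_distances le \<Gamma> = {m_distance le \<Gamma> x y | x y. True}"

definition m_distance_matrix ::
    "(nat ^ 'm \<Rightarrow> nat ^ 'm \<Rightarrow> bool) \<Rightarrow> ('m::finite \<Rightarrow> ('x \<times> 'x) set) \<Rightarrow> nat ^ 'm \<Rightarrow> real ^ 'x ^ 'x" where
  "m_distance_matrix le \<Gamma> l = (\<chi> x y. if m_distance le \<Gamma> x y = l then 1 else 0)"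

definition m_distance_regular ::
    "(nat ^ 'm \<Rightarrow> nat ^ 'm \<Rightarrow> bool) \<Rightarrow> ('m::finite \<Rightarrow> ('x::finite \<times> 'x) set) \<Rightarrow> bool" where
  "m_distance_regular le \<Gamma> \<longleftrightarrow>
     connected_partitioned_graph \<Gamma> \<and>
     (\<forall>i. axis i 1 \<in> m_distances le \<Gamma>) \<and>
     (\<forall>a\<in>m_distances le \<Gamma>. \<forall>b\<in>m_distances le \<Gamma>. \<forall>c\<in>m_distances le \<Gamma>.
        \<exists>p. \<forall>x y. m_distance le \<Gamma> x y = c \<longrightarrow>
          card {z. m_distance le \<Gamma> x z = a \<and> m_distance le \<Gamma> z y = b} = p)"

end

theory Submission
  imports Defs
begin

text \<open>
  Write \<open>M a\<close> for the monomial with exponent \<open>a\<close> in the matrices \<open>A (axis i 1)\<close>.  Since these commute,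
  the entry of \<open>M a\<close> at \<open>(x, y)\<close> is positive iff some walk from \<open>x\<close> to \<open>y\<close> has \<open>m\<close>-length \<open>a\<close>.
  Both sides of the equivalence therefore say that, for all \<open>x\<close> and \<open>y\<close>, the index of the relation
  containing \<open>(x, y)\<close> is the least \<open>a\<close> for which \<open>M a\<close> is positive at \<open>(x, y)\<close>.  For the scheme side,
  this amounts to a triangular change of basis between the \<open>A n\<close> and the \<open>M n\<close>.
\<close>

(* The simplifier would turn the index axis i 1 into axis i (Suc 0), where the lemmas about it no longer match. *)
declare One_nat_def [simp del]

section \<open>Spans and triangular families\<close>

text \<open>The coefficients are indexed by \<open>S\<close> and not by the image, so that with
  \<open>M\<close> for \<open>f\<close> they become coefficients of a polynomial, one for each
  exponent.\<close>

lemma span_image_sum: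
  fixes f :: "'i \<Rightarrow> 'v::real_vector"
  assumes "finite S" "v \<in> span (f ` S)"
  shows "\<exists>u. v = (\<Sum>s\<in>S. u s *\<^sub>R f s)"
  using assms(2)
proof (induction rule: span_induct_alt)
  case base
  show ?case by (intro exI[of _ "\<lambda>_. 0"]) simp
next
  case (step c w v)
  then obtain s u where s: "s \<in> S" "w = f s" and u: "v = (\<Sum>s\<in>S. u s *\<^sub>R f s)"
    by blast
  have "c *\<^sub>R w + v = (\<Sum>t\<in>S. (if t = s then c *\<^sub>R f t else 0) + u t *\<^sub>R f t)"
    using s u assms(1) by (simp add: sum.distrib)
  also have "\<dots> = (\<Sum>t\<in>S. ((if t = s then c else 0) + u t) *\<^sub>R f t)"
    by (intro sum.cong) (auto simp: scaleR_add_left)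
  finally show ?case by (intro exI)
qed

text \<open>Solve the relation for \<open>Q n\<close>. What remains are elements \<open>Q b\<close>
  with \<open>b\<close> below \<open>n\<close>, which by well-founded induction lie in the span of
  the \<open>P a\<close> with \<open>a\<close> below \<open>n\<close>. Both implications use this to
  pass between the \<open>A n\<close> and the \<open>M n\<close>.\<close>

lemma triangular_inverse:
  fixes P Q :: "'i \<Rightarrow> 'v::real_vector"
  assumes wf: "wfP lt" and tr: "transp lt"
    and tri: "\<And>n. n \<in> D \<Longrightarrow> \<exists>c. c \<noteq> 0 \<and> P n - c *\<^sub>R Q n \<in> span (Q ` {b\<in>D. lt b n})"
    and "n \<in> D"
  shows "\<exists>c. c \<noteq> 0 \<and> Q n - c *\<^sub>R P n \<in> span (P ` {b\<in>D. lt b n})"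
  using wf \<open>n \<in> D\<close>
proof (induction n rule: wfp_induct_rule)
  case (less n)
  obtain c where c: "c \<noteq> 0" "P n - c *\<^sub>R Q n \<in> span (Q ` {b\<in>D. lt b n})"
    using tri less.prems by blast
  let ?S = "span (P ` {b\<in>D. lt b n})"
  have "Q b \<in> ?S" if b: "b \<in> D" "lt b n" for b
  proof -
    obtain k where "Q b - k *\<^sub>R P b \<in> span (P ` {a\<in>D. lt a b})"
      using less.IH b by blast
    moreover have "P ` {a\<in>D. lt a b} \<subseteq> P ` {a\<in>D. lt a n}"
      using b tr by (auto dest: transpD)
    ultimately have "Q b - k *\<^sub>R P b \<in> ?S"
      using span_mono by blast
    moreover have "k *\<^sub>R P b \<in> ?S"
      using b by (intro span_scale span_base) auto
    ultimately show ?thesis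
      using span_add[of "Q b - k *\<^sub>R P b" _ "k *\<^sub>R P b"] by simp
  qed
  then have "span (Q ` {b\<in>D. lt b n}) \<subseteq> ?S"
    by (intro span_minimal) auto
  then have "(- inverse c) *\<^sub>R (P n - c *\<^sub>R Q n) \<in> ?S"
    using c by (intro span_scale) auto
  then have "Q n - inverse c *\<^sub>R P n \<in> ?S"
    using c(1) by (simp add: algebra_simps)
  then show ?case
    using c(1) by (intro exI[of _ "inverse c"]) simp
qed

section \<open>Exponent vectors and monomial orders\<close>

text \<open>Induction on the sum of the coordinates: some coordinate of a nonzero vector is positive
  and can be lowered by one.\<close>

lemma nat_vec_induct [case_names zero add]:
  fixes a :: "nat ^ 'm"
  assumes "P 0" and step: "\<And>i a. P a \<Longrightarrow> P (axis i 1 + a)"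
  shows "P a"
proof (induction "\<Sum>i\<in>UNIV. a $ i" arbitrary: a rule: less_induct)
  case less
  show ?case
  proof (cases "a = 0")
    case False
    then obtain i where i: "a $ i > 0"
      by (auto simp: vec_eq_iff)
    define b where "b = (\<chi> j. a $ j - axis i 1 $ j)"
    have a: "a = axis i 1 + b"
      using i by (auto simp: b_def vec_eq_iff axis_def)
    have "(\<Sum>j\<in>UNIV. b $ j) < (\<Sum>j\<in>UNIV. a $ j)"
      using i by (intro sum_strict_mono_ex1) (auto simp: b_def axis_def)
    then show ?thesis
      using less step a by metis
  qed (use assms in simp)
qed

locale monomial_ordering =
  fixes le :: "nat ^ 'm \<Rightarrow> nat ^ 'm \<Rightarrow> bool"
  assumes monomial_order: "monomial_order le"
begin

definition lt :: "nat ^ 'm \<Rightarrow> nat ^ 'm \<Rightarrow> bool" where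
  "lt a b \<longleftrightarrow> le a b \<and> a \<noteq> b"

lemma le_add_right: "le a b \<Longrightarrow> le (a + c) (b + c)"
  using monomial_order by (simp add: monomial_order_def)

lemma le_refl: "le a a"
  and le_trans: "le a b \<Longrightarrow> le b c \<Longrightarrow> le a c"
  and le_antisym: "le a b \<Longrightarrow> le b a \<Longrightarrow> a = b"
  and le_total: "le a b \<or> le b a"
proof -
  have "linear_order_on UNIV {(a, b). le a b}"
    using monomial_order by (simp add: monomial_order_def well_order_on_def)
  then have r: "refl {(a, b). le a b}" and t: "trans {(a, b). le a b}"
    and s: "antisym {(a, b). le a b}" and l: "total {(a, b). le a b}"
    by (auto simp: linear_order_on_def partial_order_on_def preorder_on_def)
  show refl: "le a a" using r by (auto dest: refl_onD)
  show "le a b \<Longrightarrow> le b c \<Longrightarrow> le a c" using t by (auto dest: transD)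
  show "le a b \<Longrightarrow> le b a \<Longrightarrow> a = b" using s by (auto dest: antisymD)
  show "le a b \<or> le b a" using l r by (cases "a = b") (auto simp: total_on_def dest: refl_onD)
qed

lemma wfP_lt: "wfP lt"
proof -
  have "wf ({(a, b). le a b} - Id)"
    using monomial_order by (simp add: monomial_order_def well_order_on_def)
  moreover have "{(a, b). le a b} - Id = {(a, b). lt a b}"
    by (auto simp: lt_def)
  ultimately show ?thesis
    by (simp add: wfp_def)
qed

lemma transp_lt: "transp lt"
  by (rule transpI) (metis lt_def le_trans le_antisym)

text \<open>By totality the only other case is \<open>le b a\<close>; translation and antisymmetry
  then give \<open>a + c = b + c\<close>, so \<open>a = b\<close>.\<close>

lemma le_add_cancel_right: "le (a + c) (b + c) \<Longrightarrow> le a b"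
  using le_total[of a b] le_add_right[of b a c] le_antisym[of "a + c" "b + c"] le_refl[of a]
  by (metis add_right_cancel)

text \<open>\<open>ord.Least\<close> is a definite description, so antisymmetry has to supply the
  uniqueness of the minimum.\<close>

lemma m_distance_eqI:
  assumes "walk (graph_edges \<Gamma>) x \<xi> y" "m_length \<Gamma> \<xi> = n"
    and "\<And>\<xi>. walk (graph_edges \<Gamma>) x \<xi> y \<Longrightarrow> le n (m_length \<Gamma> \<xi>)"
  shows "m_distance le \<Gamma> x y = n"
  unfolding m_distance_def ord.Least_def
proof (rule the_equality)
  show "(\<exists>\<xi>. walk (graph_edges \<Gamma>) x \<xi> y \<and> m_length \<Gamma> \<xi> = n) \<and>
      (\<forall>k. (\<exists>\<xi>. walk (graph_edges \<Gamma>) x \<xi> y \<and> m_length \<Gamma> \<xi> = k) \<longrightarrow> le n k)"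
    using assms by auto
next
  fix m
  assume m: "(\<exists>\<xi>. walk (graph_edges \<Gamma>) x \<xi> y \<and> m_length \<Gamma> \<xi> = m) \<and>
      (\<forall>k. (\<exists>\<xi>. walk (graph_edges \<Gamma>) x \<xi> y \<and> m_length \<Gamma> \<xi> = k) \<longrightarrow> le m k)"
  then have "le m n"
    using assms(1,2) by blast
  moreover have "le n m"
    using m assms(3) by auto
  ultimately show "m = n"
    by (rule le_antisym)
qed

text \<open>One walk makes the set of lengths nonempty. Well-foundedness then yields a minimal
  length, which is least because the order is total.\<close>

lemma m_distance_walk:
  assumes "walk (graph_edges \<Gamma>) x \<xi> y"
  shows "\<exists>\<zeta>. walk (graph_edges \<Gamma>) x \<zeta> y \<and> m_length \<Gamma> \<zeta> = m_distance le \<Gamma> x y"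
    and "le (m_distance le \<Gamma> x y) (m_length \<Gamma> \<xi>)"
proof -
  let ?L = "{m_length \<Gamma> \<zeta> | \<zeta>. walk (graph_edges \<Gamma>) x \<zeta> y}"
  have "m_length \<Gamma> \<xi> \<in> ?L"
    using assms by blast
  then obtain n where n: "n \<in> ?L" "\<And>k. lt k n \<Longrightarrow> k \<notin> ?L"
    using wfP_lt[unfolded wfp_eq_minimal, rule_format, of "m_length \<Gamma> \<xi>" ?L] by blast
  have min: "le n (m_length \<Gamma> \<zeta>)" if "walk (graph_edges \<Gamma>) x \<zeta> y" for \<zeta>
    using n(2)[of "m_length \<Gamma> \<zeta>"] that le_total[of n "m_length \<Gamma> \<zeta>"] by (auto simp: lt_def)
  obtain \<zeta> where \<zeta>: "walk (graph_edges \<Gamma>) x \<zeta> y" "m_length \<Gamma> \<zeta> = n"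
    using n(1) by blast
  have d: "m_distance le \<Gamma> x y = n"
    using \<zeta> min by (rule m_distance_eqI)
  show "\<exists>\<zeta>. walk (graph_edges \<Gamma>) x \<zeta> y \<and> m_length \<Gamma> \<zeta> = m_distance le \<Gamma> x y"
    using \<zeta> d by auto
  show "le (m_distance le \<Gamma> x y) (m_length \<Gamma> \<xi>)"
    using min assms d by blast
qed

end

section \<open>Matrix monomials\<close>

lemma mat_power_commute:
  assumes "C ** B = B ** C"
  shows "C ** mat_power B k = mat_power B k ** C"
proof (induction k)
  case (Suc k)
  then show ?case
    using assms by (simp add: mat_power_def) (metis matrix_mul_assoc)
qed (simp add: mat_power_def)

lemma mat_monomial_0: "mat_monomial B 0 = mat 1"
proof -
  have "foldr (\<lambda>i M. mat_power (B i) 0 ** M) xs (mat 1) = mat 1" for xs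
    by (induction xs) (auto simp: mat_power_def)
  then show ?thesis
    by (simp add: mat_monomial_def)
qed

text \<open>Each index occurs exactly once in the list of factors. At \<open>i\<close> the new
  factor raises the power by one; past the powers at other indices it moves to the left by
  commutativity.\<close>

lemma mat_monomial_axis_add:
  fixes B :: "'m::{finite,linorder} \<Rightarrow> real ^ 'x ^ 'x"
  assumes comm: "\<And>i j. B i ** B j = B j ** B i"
  shows "mat_monomial B (axis i 1 + a) = B i ** mat_monomial B a"
proof -
  let ?F = "\<lambda>a xs. foldr (\<lambda>i M. mat_power (B i) (a $ i) ** M) xs (mat 1)"
  have nin: "?F (axis i 1 + a) xs = ?F a xs" if "i \<notin> set xs" for xs
    using that by (induction xs) (auto simp: axis_def)
  have "?F (axis i 1 + a) xs = B i ** ?F a xs" if "distinct xs" "i \<in> set xs" for xs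
    using that
  proof (induction xs)
    case (Cons j xs)
    show ?case
    proof (cases "j = i")
      case True
      then show ?thesis
        using Cons nin by (simp add: mat_power_def matrix_mul_assoc One_nat_def)
    next
      case False
      then have "?F (axis i 1 + a) (j # xs) = mat_power (B j) (a $ j) ** (B i ** ?F a xs)"
        using Cons by (simp add: axis_def)
      also have "\<dots> = B i ** (mat_power (B j) (a $ j) ** ?F a xs)"
        by (simp only: matrix_mul_assoc mat_power_commute[OF comm])
      finally show ?thesis
        by simp
    qed
  qed simp
  then show ?thesis
    by (simp add: mat_monomial_def)
qed

lemma mat_monomial_add:
  fixes B :: "'m::{finite,linorder} \<Rightarrow> real ^ 'x ^ 'x"
  assumes comm: "\<And>i j. B i ** B j = B j ** B i"
  shows "mat_monomial B (a + b) = mat_monomial B a ** mat_monomial B b"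
proof (induction a rule: nat_vec_induct)
  case (add i a)
  have "mat_monomial B (axis i 1 + a + b) = B i ** mat_monomial B (a + b)"
    by (simp only: add.assoc mat_monomial_axis_add[OF comm])
  then show ?case
    by (simp only: add.IH matrix_mul_assoc mat_monomial_axis_add[OF comm])
qed (simp add: mat_monomial_0)

text \<open>Nonnegative summands cannot cancel, so positivity of entries behaves like composition of
  relations.\<close>

lemma matrix_mult_pos_iff:
  fixes B C :: "real ^ 'x ^ 'x"
  assumes "\<And>x y. B $ x $ y \<ge> 0" "\<And>x y. C $ x $ y \<ge> 0"
  shows "(B ** C) $ x $ y > 0 \<longleftrightarrow> (\<exists>z. B $ x $ z > 0 \<and> C $ z $ y > 0)"
proof -
  let ?f = "\<lambda>z. B $ x $ z * C $ z $ y"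
  have nonneg: "?f z \<ge> 0" for z
    using assms by simp
  have "(B ** C) $ x $ y > 0 \<longleftrightarrow> (\<Sum>z\<in>UNIV. ?f z) \<noteq> 0"
    using sum_nonneg[of UNIV ?f] nonneg by (auto simp: matrix_matrix_mult_def)
  also have "\<dots> \<longleftrightarrow> (\<exists>z. ?f z \<noteq> 0)"
    using nonneg by (subst sum_nonneg_eq_0_iff) auto
  also have "\<dots> \<longleftrightarrow> (\<exists>z. B $ x $ z > 0 \<and> C $ z $ y > 0)"
    using assms by (simp add: less_le)
  finally show ?thesis .
qed

lemma linear_matrix_mult: "linear ((**) B)" for B :: "real ^ 'x ^ 'x"
  by (rule linearI)
    (simp_all add: matrix_matrix_mult_def vec_eq_iff sum_distrib_left sum.distrib distrib_left mult_ac)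

text \<open>The keys of \<open>v\<close> can form a proper subset of \<open>S\<close>, since some
  \<open>f a\<close> may be zero; such terms do not affect the evaluation.\<close>

lemma mpoly_exists:
  fixes f :: "nat ^ 'm::{finite,linorder} \<Rightarrow> real"
  assumes "finite S"
  obtains v where "\<And>a. Poly_Mapping.lookup v a = (if a \<in> S then f a else 0)"
    and "\<And>B::'m \<Rightarrow> real ^ 'x ^ 'x. mpoly_eval v B = (\<Sum>a\<in>S. f a *\<^sub>R mat_monomial B a)"
proof -
  define v where "v = Poly_Mapping.Abs_poly_mapping (\<lambda>a. if a \<in> S then f a else 0)"
  have v: "Poly_Mapping.lookup v a = (if a \<in> S then f a else 0)" for a
    unfolding v_def using assms by (subst Abs_poly_mapping_inverse) auto
  have keys: "Poly_Mapping.keys v \<subseteq> S"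
    by (auto simp: in_keys_iff v split: if_splits)
  have "mpoly_eval v B = (\<Sum>a\<in>S. f a *\<^sub>R mat_monomial B a)" for B :: "'m \<Rightarrow> real ^ 'x ^ 'x"
    unfolding mpoly_eval_def
    by (rule sum.mono_neutral_cong_left) (use assms keys in \<open>auto simp: in_keys_iff v\<close>)
  with v that show thesis
    by blast
qed

section \<open>The graph of a symmetric association scheme\<close>

locale scheme_graph = monomial_ordering le
  for le :: "nat ^ ('m::{finite,linorder}) \<Rightarrow> nat ^ ('m::{finite,linorder}) \<Rightarrow> bool" +
  fixes D :: "(nat ^ ('m::{finite,linorder})) set"
    and A :: "nat ^ ('m::{finite,linorder}) \<Rightarrow> real ^ 'x ^ 'x"
    and \<Gamma> :: "'m::{finite,linorder} \<Rightarrow> ('x \<times> 'x) set"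
  assumes symmetric_scheme: "symmetric_association_scheme D A"
    and axis_in: "\<And>i. axis i 1 \<in> D"
    and edges_eq: "\<And>i. \<Gamma> i = {(x, y). A (axis i 1) $ x $ y = 1}"
begin

abbreviation B where
  "B i \<equiv> A (axis i 1)"

abbreviation M where
  "M \<equiv> mat_monomial B"

section \<open>The scheme as a partition of the pairs of vertices\<close>

lemma scheme: "association_scheme D A"
  using symmetric_scheme by (simp add: symmetric_association_scheme_def)

lemma finite_D: "finite D"
  using scheme by (simp add: association_scheme_def)

lemma entry_01: "n \<in> D \<Longrightarrow> A n $ x $ y = 0 \<or> A n $ x $ y = 1"
  using scheme by (auto simp: association_scheme_def)

lemma relation_nonempty: "n \<in> D \<Longrightarrow> \<exists>x y. A n $ x $ y = 1"
proof -
  assume n: "n \<in> D"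
  then have "A n \<noteq> 0"
    using scheme by (simp add: association_scheme_def)
  then show ?thesis
    using entry_01[OF n] by (auto simp: vec_eq_iff)
qed

lemma mult_closed:
  "N \<in> span (A ` D) \<Longrightarrow> N' \<in> span (A ` D) \<Longrightarrow> N ** N' \<in> span (A ` D)"
  using scheme by (simp add: association_scheme_def)

lemma entry_sym: "n \<in> D \<Longrightarrow> A n $ x $ y = A n $ y $ x"
proof -
  assume "n \<in> D"
  then have "transpose (A n) $ y $ x = A n $ y $ x"
    using symmetric_scheme by (simp add: symmetric_association_scheme_def)
  then show ?thesis
    by (simp add: transpose_def)
qed

lemma entry_sum: "(\<Sum>n\<in>D. A n $ x $ y) = 1"
proof -
  have "(\<Sum>n\<in>D. A n) $ x $ y = 1"
    using scheme by (simp add: association_scheme_def)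
  then show ?thesis
    by simp
qed

text \<open>Two relations sharing a pair would make the entries there sum to at least 2, whereas the
  sum over the whole scheme is 1.\<close>

lemma relation_unique:
  assumes "n \<in> D" "k \<in> D" "A n $ x $ y = 1" "A k $ x $ y = 1"
  shows "n = k"
proof (rule ccontr)
  assume "n \<noteq> k"
  then have "(\<Sum>j\<in>{n, k}. A j $ x $ y) = 2"
    using assms by simp
  moreover have "(\<Sum>j\<in>{n, k}. A j $ x $ y) \<le> (\<Sum>j\<in>D. A j $ x $ y)"
  proof (rule sum_mono2[OF finite_D])
    show "0 \<le> A j $ x $ y" if "j \<in> D - {n, k}" for j
      using that entry_01[of j x y] by auto
  qed (use assms in auto)
  ultimately show False
    using entry_sum[of x y] by simp
qed

lemma relation_exists: "\<exists>n\<in>D. A n $ x $ y = 1"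
proof (rule ccontr)
  assume "\<not> ?thesis"
  then have "(\<Sum>n\<in>D. A n $ x $ y) = 0"
    using entry_01 by (intro sum.neutral) blast
  then show False
    using entry_sum[of x y] by simp
qed

lemma entry_eq: "n \<in> D \<Longrightarrow> A n $ x $ y = 1 \<Longrightarrow> k \<in> D \<Longrightarrow> A k $ x $ y = (if k = n then 1 else 0)"
  by (metis relation_unique entry_01)

section \<open>Entries of matrices in the span of the scheme, and commutativity\<close>

lemma span_entry_const:
  assumes "N \<in> span (A ` D)" "n \<in> D" "A n $ x $ y = 1" "A n $ x' $ y' = 1"
  shows "N $ x $ y = N $ x' $ y'"
  using assms(1)
proof (induction rule: span_induct_alt)
  case (step c N' N)
  obtain k where "k \<in> D" "N' = A k"
    using step.hyps by blast
  then show ?case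
    using step.IH by (simp add: entry_eq[OF assms(2,3)] entry_eq[OF assms(2,4)])
qed simp

lemma span_entry_zero:
  assumes "S \<subseteq> D" "N \<in> span (A ` S)" "n \<in> D - S" "A n $ x $ y = 1"
  shows "N $ x $ y = 0"
  using assms(2)
proof (induction rule: span_induct_alt)
  case (step c N' N)
  obtain k where k: "k \<in> S" "N' = A k"
    using step.hyps by blast
  have "n \<in> D" "k \<in> D" "k \<noteq> n"
    using assms(1,3) k(1) by blast+
  then have "A k $ x $ y = 0"
    using entry_eq[OF _ assms(4)] by simp
  then show ?case
    using step.IH k(2) by simp
qed simp

text \<open>The coefficient of \<open>A n\<close> equals the entry at any pair in relation
  \<open>n\<close>, so the support of a matrix decides which \<open>A n\<close> occur in it.\<close>

lemma span_restrict:
  assumes "S \<subseteq> D" "N \<in> span (A ` D)"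
    and zero: "\<And>n x y. n \<in> D \<Longrightarrow> A n $ x $ y = 1 \<Longrightarrow> N $ x $ y \<noteq> 0 \<Longrightarrow> n \<in> S"
  shows "N \<in> span (A ` S)"
proof -
  obtain u where u: "N = (\<Sum>n\<in>D. u n *\<^sub>R A n)"
    using span_image_sum[OF finite_D assms(2)] by blast
  have "u n = 0" if n: "n \<in> D - S" for n
  proof -
    obtain x y where xy: "A n $ x $ y = 1"
      using relation_nonempty n by blast
    have "N $ x $ y = (\<Sum>k\<in>D. if k = n then u n else 0)"
      unfolding u sum_component vector_scaleR_component
      using n by (intro sum.cong) (simp_all add: entry_eq[of n x y, OF _ xy])
    also have "\<dots> = u n"
      using n finite_D by simp
    finally show ?thesis
      using zero[of n x y] n xy by auto
  qed
  then have "N = (\<Sum>n\<in>S. u n *\<^sub>R A n)"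
    unfolding u using assms(1) finite_D by (intro sum.mono_neutral_right) auto
  then show ?thesis
    by (simp only:) (intro span_sum span_scale span_base imageI)
qed

text \<open>The product lies in the span and is therefore symmetric, like each matrix of the scheme;
  transposing it exchanges the two factors.\<close>

lemma commute: "a \<in> D \<Longrightarrow> b \<in> D \<Longrightarrow> A a ** A b = A b ** A a"
proof -
  assume ab: "a \<in> D" "b \<in> D"
  have "(A a ** A b) $ x $ y = (A b ** A a) $ x $ y" for x y
  proof -
    obtain n where n: "n \<in> D" "A n $ x $ y = 1"
      using relation_exists by blast
    have "A a ** A b \<in> span (A ` D)"
      using ab by (intro mult_closed span_base) auto
    then have "(A a ** A b) $ x $ y = (A a ** A b) $ y $ x"
      using span_entry_const[of _ n x y y x] n entry_sym[of n x y] by simp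
    also have "\<dots> = (A b ** A a) $ x $ y"
      using entry_sym[OF ab(1), of y] entry_sym[OF ab(2), of _ x]
      by (simp add: matrix_matrix_mult_def mult.commute)
    finally show ?thesis .
  qed
  then show ?thesis
    by (simp add: vec_eq_iff)
qed

section \<open>Monomials in the matrices \<open>B i\<close>\<close>

lemma M_axis_add: "M (axis i 1 + a) = B i ** M a"
  by (rule mat_monomial_axis_add) (simp add: commute axis_in)

lemma M_add: "M (a + b) = M a ** M b"
  by (rule mat_monomial_add) (simp add: commute axis_in)

lemma B_nonneg: "B i $ x $ y \<ge> 0"
  using entry_01[OF axis_in, of i x y] by auto

lemma B_pos_iff: "B i $ x $ y > 0 \<longleftrightarrow> (x, y) \<in> \<Gamma> i"
  using entry_01[OF axis_in, of i x y] by (auto simp: edges_eq)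

lemma M_nonneg: "M a $ x $ y \<ge> 0"
proof (induction a arbitrary: x y rule: nat_vec_induct)
  case zero
  then show ?case by (simp add: mat_monomial_0 mat_def)
next
  case (add i a)
  have "M (axis i 1 + a) $ x $ y = (\<Sum>z\<in>UNIV. B i $ x $ z * M a $ z $ y)"
    by (simp add: M_axis_add matrix_matrix_mult_def)
  then show ?case
    using add B_nonneg by (simp add: sum_nonneg)
qed

lemma M_in_span: "M a \<in> span (A ` D)"
proof (induction a rule: nat_vec_induct)
  case zero
  then show ?case
    using scheme by (auto simp: mat_monomial_0 association_scheme_def intro: span_base)
next
  case (add i a)
  then show ?case
    unfolding M_axis_add using axis_in by (intro mult_closed) (auto intro: span_base)
qed

section \<open>Walks as positive entries of monomials\<close>

lemma disjoint_edges: "disjoint_family \<Gamma>"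
proof -
  have "i = j" if "p \<in> \<Gamma> i" "p \<in> \<Gamma> j" for i j p
    using that relation_unique[OF axis_in axis_in, of i _ _ j] by (auto simp: edges_eq axis_eq_axis)
  then show ?thesis
    by (auto simp: disjoint_family_on_def)
qed

lemma m_length_Cons:
  assumes "p \<in> \<Gamma> i"
  shows "m_length \<Gamma> (p # \<xi>) = axis i 1 + m_length \<Gamma> \<xi>"
proof -
  have "p \<in> \<Gamma> j \<longleftrightarrow> j = i" for j
    using assms disjoint_edges by (auto simp: disjoint_family_on_def)
  then show ?thesis
    by (simp add: m_length_def vec_eq_iff axis_def One_nat_def)
qed

lemma walk_imp_M_pos: "walk (graph_edges \<Gamma>) x \<xi> y \<Longrightarrow> M (m_length \<Gamma> \<xi>) $ x $ y > 0"
proof (induction \<xi> arbitrary: x)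
  case Nil
  then have "m_length \<Gamma> [] = 0"
    by (simp add: m_length_def vec_eq_iff)
  with Nil show ?case
    by (simp add: mat_monomial_0 mat_def)
next
  case (Cons p \<xi>)
  obtain v i where p: "p = (x, v)" "(x, v) \<in> \<Gamma> i" and "walk (graph_edges \<Gamma>) v \<xi> y"
    using Cons.prems by (cases p) (auto simp: graph_edges_def)
  then show ?case
    using Cons.IH[of v] B_pos_iff[of i x v] B_nonneg M_nonneg
    by (auto simp: m_length_Cons M_axis_add matrix_mult_pos_iff)
qed

text \<open>An exponent counts the edges of each class but does not order them. As the
  \<open>B i\<close> commute, whichever factor the induction splits off can supply the first
  edge.\<close>

lemma M_pos_imp_walk:
  "M a $ x $ y > 0 \<Longrightarrow> \<exists>\<xi>. walk (graph_edges \<Gamma>) x \<xi> y \<and> m_length \<Gamma> \<xi> = a"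
proof (induction a arbitrary: x rule: nat_vec_induct)
  case zero
  then show ?case
    by (intro exI[of _ "[]"]) (auto simp: mat_monomial_0 mat_def m_length_def vec_eq_iff split: if_splits)
next
  case (add i a)
  then obtain z where z: "B i $ x $ z > 0" "M a $ z $ y > 0"
    using B_nonneg M_nonneg by (auto simp: M_axis_add matrix_mult_pos_iff)
  obtain \<xi> where "walk (graph_edges \<Gamma>) z \<xi> y" "m_length \<Gamma> \<xi> = a"
    using add.IH z by blast
  moreover have "(x, z) \<in> \<Gamma> i"
    using z B_pos_iff by blast
  ultimately show ?case
    by (intro exI[of _ "(x, z) # \<xi>"]) (auto simp: m_length_Cons graph_edges_def)
qed

section \<open>Least exponents and distance-regularity\<close>

definition least_exponents :: bool where
  "least_exponents \<longleftrightarrow> (\<forall>n\<in>D. \<forall>x y. A n $ x $ y = 1 \<longrightarrow>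
     M n $ x $ y > 0 \<and> (\<forall>a. M a $ x $ y > 0 \<longrightarrow> le n a))"

lemma least_exponents_if_distance_regular:
  assumes "m_distance_regular le \<Gamma>" "D = m_distances le \<Gamma>"
    and matrix: "\<forall>l\<in>D. A l = m_distance_matrix le \<Gamma> l"
  shows least_exponents
  unfolding least_exponents_def
proof (intro ballI allI impI)
  fix n x y
  assume n: "n \<in> D" "A n $ x $ y = 1"
  then have d: "m_distance le \<Gamma> x y = n"
    using matrix by (auto simp: m_distance_matrix_def split: if_splits)
  obtain \<xi> where "walk (graph_edges \<Gamma>) x \<xi> y"
    using assms(1) unfolding m_distance_regular_def connected_partitioned_graph_def by blast
  from m_distance_walk(1)[OF this] have "M n $ x $ y > 0"
    using walk_imp_M_pos d by metis
  moreover have "le n a" if "M a $ x $ y > 0" for a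
    using M_pos_imp_walk[OF that] m_distance_walk(2)[of \<Gamma> x _ y] d by auto
  ultimately show "M n $ x $ y > 0 \<and> (\<forall>a. M a $ x $ y > 0 \<longrightarrow> le n a)"
    by blast
qed

lemma distance_regular_if_least_exponents:
  assumes least_exponents
  shows "m_distance_regular le \<Gamma>" "D = m_distances le \<Gamma>"
    "\<forall>l\<in>D. A l = m_distance_matrix le \<Gamma> l"
proof -
  have walk: "\<exists>\<xi>. walk (graph_edges \<Gamma>) x \<xi> y \<and> m_length \<Gamma> \<xi> = n"
    if "n \<in> D" "A n $ x $ y = 1" for n x y
    using assms that M_pos_imp_walk by (auto simp: least_exponents_def)
  have dist: "m_distance le \<Gamma> x y = n" if n: "n \<in> D" "A n $ x $ y = 1" for n x y
  proof -
    obtain \<xi> where \<xi>: "walk (graph_edges \<Gamma>) x \<xi> y" "m_length \<Gamma> \<xi> = n"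
      using walk n by blast
    moreover have "le n (m_length \<Gamma> \<xi>)" if "walk (graph_edges \<Gamma>) x \<xi> y" for \<xi>
      using assms n walk_imp_M_pos[OF that] by (auto simp: least_exponents_def)
    ultimately show ?thesis
      by (rule m_distance_eqI)
  qed
  have entry: "A n $ x $ y = (if m_distance le \<Gamma> x y = n then 1 else 0)" if n: "n \<in> D" for n x y
    using relation_exists[of x y] dist entry_eq[OF _ _ n, of _ x y] by metis
  then show "\<forall>l\<in>D. A l = m_distance_matrix le \<Gamma> l"
    by (simp add: m_distance_matrix_def vec_eq_iff)
  have "m_distance le \<Gamma> x y \<in> D" for x y
    using relation_exists[of x y] dist by auto
  moreover have "\<exists>x y. n = m_distance le \<Gamma> x y" if "n \<in> D" for n
    using relation_nonempty[OF that] dist[OF that] by metis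
  ultimately show D: "D = m_distances le \<Gamma>"
    by (auto simp: m_distances_def)
  have "\<Gamma> i \<noteq> {}" for i
    using relation_nonempty[OF axis_in] by (auto simp: edges_eq)
  moreover have "sym (\<Gamma> i)" for i
    using entry_sym[OF axis_in] by (auto simp: edges_eq sym_def)
  moreover have "\<exists>\<xi>. walk (graph_edges \<Gamma>) x \<xi> y" for x y
    using relation_exists[of x y] walk by blast
  ultimately have "connected_partitioned_graph \<Gamma>"
    using disjoint_edges by (simp add: connected_partitioned_graph_def)
  moreover have "\<exists>p. \<forall>x y. m_distance le \<Gamma> x y = c \<longrightarrow>
      card {z. m_distance le \<Gamma> x z = a \<and> m_distance le \<Gamma> z y = b} = p"
    if abc: "a \<in> D" "b \<in> D" "c \<in> D" for a b c
  proof -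
    let ?C = "\<lambda>x y. card {z. m_distance le \<Gamma> x z = a \<and> m_distance le \<Gamma> z y = b}"
    \<comment> \<open>Entries of the product count intermediate vertices. Since the product lies in
      the span, it is constant on relation \<open>c\<close>, and that constant is the intersection
      number \<open>p\<close>.\<close>
    have count: "(A a ** A b) $ x $ y = real (?C x y)" for x y
    proof -
      have "(A a ** A b) $ x $ y =
          (\<Sum>z\<in>UNIV. if m_distance le \<Gamma> x z = a \<and> m_distance le \<Gamma> z y = b then 1 else 0)"
        using abc by (auto simp: matrix_matrix_mult_def entry intro!: sum.cong)
      also have "\<dots> = real (?C x y)"
        by (simp add: sum.If_cases)
      finally show ?thesis .
    qed
    have "A a ** A b \<in> span (A ` D)"
      using abc by (intro mult_closed span_base) auto
    moreover obtain u v where "A c $ u $ v = 1"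
      using relation_nonempty[OF abc(3)] by blast
    ultimately have "?C x y = ?C u v" if "m_distance le \<Gamma> x y = c" for x y
      using span_entry_const[of "A a ** A b" c x y u v] abc(3) that by (simp add: entry count)
    then show ?thesis
      by blast
  qed
  ultimately show "m_distance_regular le \<Gamma>"
    using axis_in D by (simp add: m_distance_regular_def)
qed

section \<open>Least exponents and the P-polynomial property\<close>

lemma P_polynomial_if_least_exponents:
  assumes least_exponents
  shows "P_polynomial_scheme le D A"
proof -
  have pos: "M n $ x $ y > 0" if "n \<in> D" "A n $ x $ y = 1" for n x y
    using assms that by (simp add: least_exponents_def)
  have least: "le n a" if "n \<in> D" "A n $ x $ y = 1" "M a $ x $ y > 0" for n a x y
    using assms that by (auto simp: least_exponents_def)
  have least': "le n a" if "n \<in> D" "A n $ x $ y = 1" "M a $ x $ y \<noteq> 0" for n a x y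
    using least[of n x y a] M_nonneg[of a x y] that by simp

  \<comment> \<open>Split \<open>M n\<close> at a vertex \<open>z\<close> into \<open>M n'\<close>
    and \<open>M k\<close>, and let \<open>r\<close> be the index of \<open>(x, z)\<close>.
    Leastness at \<open>(x, z)\<close> gives \<open>le r n'\<close>. Replacing the first factor by
    \<open>M r\<close> keeps the entry at \<open>(x, y)\<close> positive, so leastness of
    \<open>n\<close> there gives \<open>le (n' + k) (r + k)\<close>. Hence
    \<open>n' = r\<close>.\<close>
  have down: "n' \<in> D" if n: "n \<in> D" and le: "\<forall>i. n' $ i \<le> n $ i" for n n'
  proof -
    define k where "k = (\<chi> i. n $ i - n' $ i)"
    have nk: "n = n' + k"
      using le by (simp add: k_def vec_eq_iff)
    obtain x y where xy: "A n $ x $ y = 1"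
      using relation_nonempty[OF n] by blast
    obtain z where z: "M n' $ x $ z > 0" "M k $ z $ y > 0"
      using pos[OF n xy] M_nonneg by (auto simp: nk M_add matrix_mult_pos_iff)
    obtain r where r: "r \<in> D" "A r $ x $ z = 1"
      using relation_exists by blast
    have "M (r + k) $ x $ y > 0"
      using pos[OF r] z M_nonneg by (auto simp: M_add matrix_mult_pos_iff)
    then have "le (n' + k) (r + k)"
      using least n xy nk by blast
    then have "le n' r"
      by (rule le_add_cancel_right)
    moreover have "le r n'"
      using least r z by blast
    ultimately show ?thesis
      using le_antisym r by blast
  qed

  have "\<exists>c. c \<noteq> 0 \<and> M n - c *\<^sub>R A n \<in> span (A ` {b\<in>D. lt b n})" if n: "n \<in> D" for n
  proof -
    obtain x y where xy: "A n $ x $ y = 1"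
      using relation_nonempty[OF n] by blast
    \<comment> \<open>The entry of \<open>M n\<close> on relation \<open>n\<close> is the
      coefficient of \<open>A n\<close>. Subtracting that term leaves support only on relations with
      smaller index.\<close>
    let ?N = "M n - M n $ x $ y *\<^sub>R A n"
    have "?N \<in> span (A ` D)"
      using n by (intro span_diff M_in_span span_scale span_base) auto
    moreover have "lt k n" if k: "k \<in> D" "A k $ x' $ y' = 1" "?N $ x' $ y' \<noteq> 0" for k x' y'
    proof (cases "k = n")
      case True
      then show ?thesis
        using span_entry_const[OF M_in_span n xy, of x' y' n] k by simp
    next
      case False
      then have "M n $ x' $ y' \<noteq> 0"
        using k entry_eq[OF k(1,2) n] by auto
      then show ?thesis
        using least'[OF k(1,2)] False by (simp add: lt_def)
    qed
    ultimately have "?N \<in> span (A ` {b\<in>D. lt b n})"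
      by (intro span_restrict[of "{b\<in>D. lt b n}"]) blast+
    then show ?thesis
      using pos[OF n xy] by (intro exI[of _ "M n $ x $ y"]) simp
  qed
  then have tri: "\<exists>c. c \<noteq> 0 \<and> A n - c *\<^sub>R M n \<in> span (M ` {b\<in>D. lt b n})" if "n \<in> D" for n
    using triangular_inverse[OF wfP_lt transp_lt, of D M A] that by blast

  have poly: "\<exists>v. has_multidegree le v n \<and> Poly_Mapping.keys v \<subseteq> D \<and> A n = mpoly_eval v B"
    if n: "n \<in> D" for n
  proof -
    let ?L = "{b\<in>D. lt b n}"
    obtain c where c: "c \<noteq> 0" "A n - c *\<^sub>R M n \<in> span (M ` ?L)"
      using tri n by blast
    have fin: "finite ?L"
      using finite_D by simp
    obtain u where u: "A n - c *\<^sub>R M n = (\<Sum>b\<in>?L. u b *\<^sub>R M b)"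
      using span_image_sum[OF fin c(2)] by blast
    \<comment> \<open>The leading coefficient \<open>c\<close> is placed at \<open>n\<close>, which
      is outside \<open>?L\<close>, so the update does not disturb the lower coefficients
      \<open>u\<close>.\<close>
    obtain v where v: "\<And>a. Poly_Mapping.lookup v a = (if a \<in> insert n ?L then (u(n := c)) a else 0)"
      and ev: "mpoly_eval v B = (\<Sum>a\<in>insert n ?L. (u(n := c)) a *\<^sub>R M a)"
      using mpoly_exists[of "insert n ?L"] fin by blast
    have "(\<Sum>a\<in>?L. (u(n := c)) a *\<^sub>R M a) = (\<Sum>b\<in>?L. u b *\<^sub>R M b)"
      by (intro sum.cong) (auto simp: lt_def)
    then have "A n = mpoly_eval v B"
      unfolding ev using fin u[symmetric] by (subst sum.insert) (auto simp: lt_def)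
    moreover have "Poly_Mapping.keys v \<subseteq> insert n ?L"
      by (auto simp: in_keys_iff v split: if_splits)
    then have "has_multidegree le v n" "Poly_Mapping.keys v \<subseteq> D"
      using n c(1) le_refl by (auto simp: has_multidegree_def v lt_def)
    ultimately show ?thesis
      by blast
  qed

  \<comment> \<open>Here \<open>a\<close> ranges over all exponents, because
    \<open>a + axis i 1\<close> may leave \<open>D\<close>. Expand \<open>M a\<close> in the
    \<open>A b\<close> that meet its support, then each \<open>A b\<close> in monomials by
    \<open>tri\<close>.\<close>
  have "M a \<in> span (M ` {b\<in>D. le b a})" for a
  proof -
    have "M a \<in> span (A ` {b\<in>D. le b a})"
      by (rule span_restrict[OF _ M_in_span]) (use least' in auto)
    moreover have "A n \<in> span (M ` {b\<in>D. le b a})" if n: "n \<in> D" "le n a" for n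
    proof -
      obtain c where "A n - c *\<^sub>R M n \<in> span (M ` {b\<in>D. lt b n})"
        using tri n by blast
      moreover have "M ` {b\<in>D. lt b n} \<subseteq> M ` {b\<in>D. le b a}"
        using n le_trans by (auto simp: lt_def)
      ultimately have "A n - c *\<^sub>R M n \<in> span (M ` {b\<in>D. le b a})"
        using span_mono by blast
      moreover have "c *\<^sub>R M n \<in> span (M ` {b\<in>D. le b a})"
        using n by (intro span_scale span_base) auto
      ultimately show ?thesis
        using span_add[of "A n - c *\<^sub>R M n" _ "c *\<^sub>R M n"] by simp
    qed
    then have "span (A ` {b\<in>D. le b a}) \<subseteq> span (M ` {b\<in>D. le b a})"
      by (intro span_minimal) auto
    ultimately show ?thesis
      by blast
  qed
  \<comment> \<open>The product is itself the monomial with exponent \<open>axis i 1 + a\<close>, so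
    the preceding expansion applies.\<close>
  then have "B i ** M a \<in> span {M b | b. b \<in> D \<and> le b (a + axis i 1)}" for i a
    by (simp only: M_axis_add[symmetric] setcompr_eq_image add.commute[of a])
  then show ?thesis
    unfolding P_polynomial_scheme_def commutative_association_scheme_def
    using scheme commute axis_in down poly by blast
qed

text \<open>Multidegrees express the \<open>A n\<close> triangularly through the \<open>M n\<close>.
  Inverting this and reducing all monomials to exponents in \<open>D\<close> bounds the relations on
  which each \<open>M a\<close> can be nonzero.\<close>

lemma least_exponents_if_P_polynomial:
  assumes P: "P_polynomial_scheme le D A"
  shows least_exponents
proof -
  have prod: "B i ** M a \<in> span (M ` {b\<in>D. le b (a + axis i 1)})" if "a \<in> D" for i a
    using P that by (simp add: P_polynomial_scheme_def setcompr_eq_image)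
  have "\<exists>c. c \<noteq> 0 \<and> A n - c *\<^sub>R M n \<in> span (M ` {b\<in>D. lt b n})" if n: "n \<in> D" for n
  proof -
    obtain v where v: "has_multidegree le v n" "Poly_Mapping.keys v \<subseteq> D" "A n = mpoly_eval v B"
      using P n by (auto simp: P_polynomial_scheme_def)
    let ?c = "Poly_Mapping.lookup v n"
    have "n \<in> Poly_Mapping.keys v"
      using v(1) by (simp add: has_multidegree_def in_keys_iff)
    then have "A n - ?c *\<^sub>R M n =
        (\<Sum>a\<in>Poly_Mapping.keys v - {n}. Poly_Mapping.lookup v a *\<^sub>R M a)"
      unfolding v(3) mpoly_eval_def by (simp add: sum.remove)
    also have "\<dots> \<in> span (M ` {b\<in>D. lt b n})"
      using v(1,2) by (intro span_sum span_scale span_base) (auto simp: has_multidegree_def lt_def)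
    finally show ?thesis
      using v(1) by (auto simp: has_multidegree_def)
  qed
  then have tri: "\<exists>c. c \<noteq> 0 \<and> M n - c *\<^sub>R A n \<in> span (A ` {b\<in>D. lt b n})" if "n \<in> D" for n
    using triangular_inverse[OF wfP_lt transp_lt, of D A M] that by blast

  \<comment> \<open>Downward closure below any \<open>axis i 1\<close>; the base of the next
    induction needs it.\<close>
  have "0 \<in> D"
    using P axis_in unfolding P_polynomial_scheme_def by (metis zero_index zero_le)
  \<comment> \<open>This extends the product condition from exponents in \<open>D\<close> to all
    exponents. Multiplication by \<open>B i\<close> is linear, and translation invariance turns the
    bound \<open>a\<close> into \<open>axis i 1 + a\<close>.\<close>
  have MM: "M a \<in> span (M ` {b\<in>D. le b a})" for a
  proof (induction a rule: nat_vec_induct)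
    case zero
    then show ?case
      using \<open>0 \<in> D\<close> le_refl by (auto intro: span_base)
  next
    case (add i a)
    let ?S = "span (M ` {b\<in>D. le b (axis i 1 + a)})"
    have "B i ** M b \<in> ?S" if b: "b \<in> D" "le b a" for b
    proof -
      have "M ` {c\<in>D. le c (b + axis i 1)} \<subseteq> M ` {c\<in>D. le c (axis i 1 + a)}"
        using b le_trans le_add_right[of b a "axis i 1"] by (auto simp: add.commute)
      then show ?thesis
        using prod[of b i] b span_mono by blast
    qed
    then have "span ((**) (B i) ` M ` {b\<in>D. le b a}) \<subseteq> ?S"
      by (intro span_minimal) auto
    then show ?case
      using add.IH by (auto simp: M_axis_add linear_span_image[OF linear_matrix_mult])
  qed

  have MA: "M a \<in> span (A ` {b\<in>D. le b a})" for a
  proof -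
    have "M n \<in> span (A ` {b\<in>D. le b a})" if n: "n \<in> D" "le n a" for n
    proof -
      obtain c where "M n - c *\<^sub>R A n \<in> span (A ` {b\<in>D. lt b n})"
        using tri n by blast
      moreover have "A ` {b\<in>D. lt b n} \<subseteq> A ` {b\<in>D. le b a}"
        using n le_trans by (auto simp: lt_def)
      ultimately have "M n - c *\<^sub>R A n \<in> span (A ` {b\<in>D. le b a})"
        using span_mono by blast
      moreover have "c *\<^sub>R A n \<in> span (A ` {b\<in>D. le b a})"
        using n by (intro span_scale span_base) auto
      ultimately show ?thesis
        using span_add[of "M n - c *\<^sub>R A n" _ "c *\<^sub>R A n"] by simp
    qed
    then have "span (M ` {b\<in>D. le b a}) \<subseteq> span (A ` {b\<in>D. le b a})"
      by (intro span_minimal) auto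
    with MM show ?thesis
      by blast
  qed

  show ?thesis
    unfolding least_exponents_def
  proof (intro ballI allI impI conjI)
    fix n x y
    assume n: "n \<in> D" "A n $ x $ y = 1"
    obtain c where c: "c \<noteq> 0" "M n - c *\<^sub>R A n \<in> span (A ` {b\<in>D. lt b n})"
      using tri n by blast
    \<comment> \<open>On relation \<open>n\<close> the lower terms vanish, so the entry of
      \<open>M n\<close> is \<open>c\<close>, which is nonzero; it is positive because monomials
      have nonnegative entries.\<close>
    have "(M n - c *\<^sub>R A n) $ x $ y = 0"
      by (rule span_entry_zero[OF _ c(2) _ n(2)]) (use n in \<open>auto simp: lt_def\<close>)
    then show "M n $ x $ y > 0"
      using n c(1) M_nonneg[of n x y] by simp
    \<comment> \<open>If \<open>le n a\<close> failed, \<open>MA\<close> would express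
      \<open>M a\<close> through relations other than \<open>n\<close>, and its entry at
      \<open>(x, y)\<close> would be zero.\<close>
    show "le n a" if "M a $ x $ y > 0" for a
      using span_entry_zero[OF _ MA, of a n x y] n that by fastforce
  qed
qed

end

theorem theorem3p12:
  fixes le :: "nat ^ ('m::{finite,linorder}) \<Rightarrow> nat ^ ('m::{finite,linorder}) \<Rightarrow> bool"
    and D :: "(nat ^ ('m::{finite,linorder})) set"
    and A :: "nat ^ ('m::{finite,linorder}) \<Rightarrow> real ^ 'x ^ 'x"
    and \<Gamma> :: "'m::{finite,linorder} \<Rightarrow> ('x \<times> 'x) set"
  assumes "monomial_order le"
    and "symmetric_association_scheme D A"
    and "\<And>i. axis i 1 \<in> D"
    and "\<And>i. \<Gamma> i = {(x, y). A (axis i 1) $ x $ y = 1}"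
  shows "(m_distance_regular le \<Gamma> \<and> D = m_distances le \<Gamma> \<and>
            (\<forall>l\<in>D. A l = m_distance_matrix le \<Gamma> l)) \<longleftrightarrow>
         (symmetric_association_scheme D A \<and> P_polynomial_scheme le D A)"
proof -
  interpret scheme_graph le D A \<Gamma>
    by unfold_locales (use assms in auto)
  show ?thesis
    using assms(2) least_exponents_if_distance_regular distance_regular_if_least_exponents
      P_polynomial_if_least_exponents least_exponents_if_P_polynomial
    by blast
qed

end
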